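(* Let $k\ge 4$ be an integer and use the setting, operators $\mathcal L_i,\mathcal N_i$, residuals $\mathcal R_i$, weights $\Phi_i,\Phi_{i,k}$ and energies $\mathfrak E_0,\mathfrak H_k,\mathfrak E_k$ described in the context. Let $0<T\le\infty$ and let $\delta(t)$, $t\in[0,T)$, be a solution, in the class of admissible perturbations, of $$\partial_t\delta\omega=\mathcal L_\omega(\delta)+\mathcal N_\omega(\delta)+\mathcal R_\omega,\qquad \partial_t\partial_r\delta u=\partial_r\mathcal L_u(\delta)+\mathcal N_r(\delta)+\mathcal R_r,\qquad \partial_t\partial_z\delta u=\partial_z\mathcal L_u(\delta)+\mathcal N_z(\delta)+\mathcal R_z .$$ Let $\Lambda_{\mathcal L}^{\rm low},\Lambda_{\mathcal L}^{\rm high},\Lambda_{D^\alpha\mathcal L}^{\rm low},\Lambda_{D^\alpha\mathcal L}^{\rm high},\Lambda_{\mathcal N,3},\Lambda_{D^\alpha\mathcal N,3},\Lambda_{\mathcal R}$ be finite constants and $0<\mu_k\le 1$, with $\mathfrak E_k^2=\mathfrak E_0^2+\mu_k\mathfrak H_k^2$. Assume that the following estimates hold along the solution for all $t\in[0,T)$: $$\langle \mathcal L_\omega,\delta\omega\rangle_{\Phi_\omega}+\langle\partial_r\mathcal L_u,\partial_r\delta u\rangle_{\Phi_r}+\langle\partial_z\mathcal L_u,\partial_z\delta u\rangle_{\Phi_z}\le-\Lambda_{\mathcal L}^{\rm low}\mathfrak E_0^2+\Lambda_{\mathcal L}^{\rm high}\mathfrak H_k^2,$$ $$\sum_{i\in\{\omega,r,z\}}\sum_{|\alpha|=k}\langle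 D^\alpha\mathcal L_i,D^\alpha\delta v_i\rangle_{\Phi_{i,k}}\le\Lambda_{D^\alpha\mathcal L}^{\rm low}\mathfrak E_0^2-\Lambda_{D^\alpha\mathcal L}^{\rm high}\mathfrak H_k^2,$$ $$\Big|\langle\mathcal N_\omega,\delta\omega\rangle_{\Phi_\omega}+\langle\mathcal N_r,\partial_r\delta u\rangle_{\Phi_r}+\langle\mathcal N_z,\partial_z\delta u\rangle_{\Phi_z}\Big|\le\Lambda_{\mathcal N,3}\,\mathfrak E_k^3,$$ $$\mu_k\Big|\sum_{i\in\{\omega,r,z\}}\sum_{|\alpha|=k}\langle D^\alpha\mathcal N_i,D^\alpha\delta v_i\rangle_{\Phi_{i,k}}\Big|\le\Lambda_{D^\alpha\mathcal N,3}\,\mathfrak E_k^3,$$ $$\Big|\sum_{i\in\{\omega,r,z\}}\langle\mathcal R_i,\delta v_i\rangle_{\Phi_i}+\mu_k\sum_{i\in\{\omega,r,z\}}\sum_{|\alpha|=k}\langle D^\alpha\mathcal R_i,D^\alpha\delta v_i\rangle_{\Phi_{i,k}}\Big|\le\Lambda_{\mathcal R}\,\mathfrak E_k .$$ Assume that $\mu_k$ is such that $$\Lambda_{\rm stab}:=\min\Big\{\Lambda_{\mathcal L}^{\rm low}-\mu_k\Lambda_{D^\alpha\mathcal L}^{\rm low},\ \Lambda_{D^\alpha\mathcal L}^{\rm high}-\frac{\Lambda_{\mathcal L}^{\rm high}}{\mu_k}\Big\}>0,$$ set $\Lambda_3:=\Lambda_{\mathcal N,3}+\Lambda_{D^\alpha\mathcal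 N,3}$, and assume that $\delta_*>0$ satisfies $$\Lambda_3\,\delta_*+\frac{\Lambda_{\mathcal R}}{\delta_*}<\Lambda_{\rm stab}.$$ If $\mathfrak E_k(0)<\delta_*$, then $\mathfrak E_k(t)<\delta_*$ for all $t\in[0,T)$. (That is, the solution remains in the ball $\{\mathfrak E_k<\delta_*\}$ for as long as it exists and the estimates apply.)
   Context: Domain and notation. $\mathbb D=\{(r,z):r\ge0,\ z\in\mathbb R\}$, $\lambda=1/2$, $\mathcal E f=\partial_r^2f+\frac3r\partial_rf+\partial_z^2f$ (at $r=0$, for $f$ even in $r$, understood as $4\partial_{rr}f+\partial_{zz}f$). A subscript $0$ denotes evaluation at $(r,z)=(0,0)$. For a multi-index $\alpha=(\alpha_1,\alpha_2)$, $D^\alpha=\partial_r^{\alpha_1}\partial_z^{\alpha_2}$. Approximate profile. Fixed sufficiently regular functions $\bar u,\bar\psi$ of $(r,z)$ and constants $\bar C,\bar c_u$, with $\bar\omega:=-\mathcal E\bar\psi$, $\bar u^r=-r\partial_z\bar\psi$, $\bar u^z=2\bar\psi+r\partial_r\bar\psi$, normalized so that $\bar C+2\bar\psi_0=0$ and $\bar u_0\neq0$. Raw residuals: $\mathcal R_u^{\mathsf{raw}}=-(\lambda r+\bar u^r)\partial_r\bar u-(\lambda z+\bar C+\bar u^z)\partial_z\bar u+2\bar u\,\partial_z\bar\psi+\bar c_u\bar u$, $\mathcal R_\omega^{\mathsf{raw}}=-(\lambda r+\bar u^r)\partial_r\bar\omega-(\lambda z+\bar C+\bar u^z)\partial_z\bar\omega+2\bar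 u\,\partial_z\bar u+(\bar c_u-\lambda)\bar\omega$. Put $c_{u,\mathrm{res}}=-\mathcal R_u^{\mathsf{raw}}(0,0)/\bar u_0$, $\mathcal R_u=\mathcal R_u^{\mathsf{raw}}+c_{u,\mathrm{res}}\bar u$, $\mathcal R_\omega=\mathcal R_\omega^{\mathsf{raw}}+c_{u,\mathrm{res}}\bar\omega$, $\mathcal R_r=\partial_r\mathcal R_u$, $\mathcal R_z=\partial_z\mathcal R_u$. Perturbations. $\delta$ denotes the collection of $\delta u,\delta\omega,\delta\psi$ (functions of $(r,z,t)$) and $\delta C,\delta c_u$ (functions of $t$), where $-\mathcal E\delta\psi=\delta\omega$, $\delta u_0=0$, $\delta C=-2\,\delta\psi_0$, $\delta c_u=-2(\partial_z\delta\psi)_0$. Put $\delta u^r=-r\partial_z\delta\psi$, $\delta u^z=2\delta\psi+r\partial_r\delta\psi$, and $\delta v_\omega=\delta\omega$, $\delta v_r=\partial_r\delta u$, $\delta v_z=\partial_z\delta u$. Operators. $\mathcal L_u(\delta)=(2\partial_z\bar\psi+\bar c_u+c_{u,\mathrm{res}})\delta u-(\lambda r+\bar u^r)\partial_r\delta u-(\lambda z+\bar C+\bar u^z)\partial_z\delta u+(2\bar u+r\partial_r\bar u)\partial_z\delta\psi-r\,\partial_z\bar u\,\partial_r\delta\psi-2\,\partial_z\bar u\,\delta\psi-\partial_z\bar u\,\delta C+\bar u\,\delta c_u$; $\mathcal L_\omega(\delta)=(\bar c_u+c_{u,\mathrm{res}}-\lambda)\delta\omega-(\lambda r+\bar u^r)\partial_r\delta\omega-(\lambda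 z+\bar C+\bar u^z)\partial_z\delta\omega+2\,\partial_z\bar u\,\delta u+2\bar u\,\partial_z\delta u-2\,\partial_z\bar\omega\,\delta\psi+r\,\partial_r\bar\omega\,\partial_z\delta\psi-r\,\partial_z\bar\omega\,\partial_r\delta\psi-\partial_z\bar\omega\,\delta C+\bar\omega\,\delta c_u$; $\mathcal N_u(\delta)=r\,\partial_z\delta\psi\,\partial_r\delta u-(\delta C+2\delta\psi+r\partial_r\delta\psi)\partial_z\delta u+2\,\delta u\,\partial_z\delta\psi+\delta c_u\,\delta u$; $\mathcal N_\omega(\delta)=-\delta u^r\,\partial_r\delta\omega-(\delta C+\delta u^z)\partial_z\delta\omega+2\,\delta u\,\partial_z\delta u+\delta c_u\,\delta\omega$; $\mathcal L_r=\partial_r\mathcal L_u$, $\mathcal L_z=\partial_z\mathcal L_u$, $\mathcal N_r=\partial_r\mathcal N_u$, $\mathcal N_z=\partial_z\mathcal N_u$. Weights and energies. For a positive weight $\phi$ on $\mathbb D$: $\langle f,g\rangle_\phi=\int_{\mathbb D}fg\,\phi\,dr\,dz$, $\|f\|_\phi^2=\langle f,f\rangle_\phi$. The weights $\Phi_\omega,\Phi_r,\Phi_z:\mathbb D\to(0,\infty)$ are bounded below by a positive constant a.e., locally integrable (possibly singular at the origin), $C^1$ (or as regular as needed) away from the origin, and $\min\{\Phi_r,\Phi_z\}\ge c\,\rho$ for $\rho$ large and some $c>0$, where $\rho=r^2+z^2$. Set $\Phi_{i,k}=1+\rho^k\Phi_i$ for $i\in\{\omega,r,z\}$ and $\mathfrak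 E_0^2=\sum_{i\in\{\omega,r,z\}}\|\delta v_i\|_{\Phi_i}^2$, $\ \mathfrak H_k^2=\sum_{i\in\{\omega,r,z\}}\sum_{|\alpha|=k}\|D^\alpha\delta v_i\|_{\Phi_{i,k}}^2$, $\ \mathfrak E_k^2=\mathfrak E_0^2+\mu_k\mathfrak H_k^2$ (with $\mathfrak E_0,\mathfrak H_k,\mathfrak E_k\ge0$). Admissible perturbations. They are even in $r$, decay at infinity, and have the weighted regularity and integrability needed for the energies and all pairings to be finite and for the energy identity to hold: along a solution in the admissible class, $t\mapsto\mathfrak E_k(t)^2$ is continuous on $[0,T)$ and differentiable on $(0,T)$ with $\frac12\frac{d}{dt}\mathfrak E_k^2=\sum_i\langle\partial_t\delta v_i,\delta v_i\rangle_{\Phi_i}+\mu_k\sum_i\sum_{|\alpha|=k}\langle D^\alpha\partial_t\delta v_i,D^\alpha\delta v_i\rangle_{\Phi_{i,k}}$. *)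

theory Defs
  imports "HOL-Analysis.Analysis"
begin

text \<open>
  Points are pairs \<open>(r, z)\<close>. A function on the half-plane that is even in \<open>r\<close> is represented
  by its even extension to the whole plane, so that derivatives at \<open>r = 0\<close> are ordinary two-sided
  derivatives. Pairings, norms, weights and evolution equations refer to the half-plane only.
\<close>

type_synonym field = "real \<times> real \<Rightarrow> real"

definition half_plane :: "(real \<times> real) set" where
  "half_plane = {x. fst x \<ge> 0}"

definition even_r :: "field \<Rightarrow> bool" where
  "even_r f \<longleftrightarrow> (\<forall>r z. f (- r, z) = f (r, z))"

definition dr :: "field \<Rightarrow> field" where
  "dr f = (\<lambda>(r, z). deriv (\<lambda>s. f (s, z)) r)"

definition dz :: "field \<Rightarrow> field" where
  "dz f = (\<lambda>(r, z). deriv (\<lambda>s. f (r, s)) z)"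

definition partial :: "nat \<times> nat \<Rightarrow> field \<Rightarrow> field" where
  "partial \<alpha> f = (dr ^^ fst \<alpha>) ((dz ^^ snd \<alpha>) f)"

definition multi_indices :: "nat \<Rightarrow> (nat \<times> nat) set" where
  "multi_indices k = {\<alpha>. fst \<alpha> + snd \<alpha> = k}"

text \<open>\<open>Ck_on n f S\<close> is meant for open \<open>S\<close>; it says that \<open>f\<close> is of class \<open>C\<close>-\<open>n\<close> on \<open>S\<close>.\<close>

primrec Ck_on :: "nat \<Rightarrow> field \<Rightarrow> (real \<times> real) set \<Rightarrow> bool" where
  "Ck_on 0 f S \<longleftrightarrow> continuous_on S f"
| "Ck_on (Suc n) f S \<longleftrightarrow>
     continuous_on S f \<and>
     (\<forall>(r, z) \<in> S. (\<lambda>s. f (s, z)) differentiable (at r) \<and> (\<lambda>s. f (r, s)) differentiable (at z)) \<and>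
     Ck_on n (dr f) S \<and> Ck_on n (dz f) S"

text \<open>For \<open>f\<close> even in \<open>r\<close>, the limit of \<open>3 / r * dr f\<close> at the axis is \<open>3 * dr (dr f)\<close>.\<close>

definition elliptic :: "field \<Rightarrow> field" where
  "elliptic f = (\<lambda>(r, z).
     if r = 0 then 4 * dr (dr f) (0, z) + dz (dz f) (0, z)
     else dr (dr f) (r, z) + 3 / r * dr f (r, z) + dz (dz f) (r, z))"

definition vel_r :: "field \<Rightarrow> field" where
  "vel_r \<psi> = (\<lambda>(r, z). - r * dz \<psi> (r, z))"

definition vel_z :: "field \<Rightarrow> field" where
  "vel_z \<psi> = (\<lambda>(r, z). 2 * \<psi> (r, z) + r * dr \<psi> (r, z))"

definition lam :: real where
  "lam = 1 / 2"


section \<open>Approximate profile and residuals\<close>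

record profile =
  ubar :: field
  psibar :: field
  Cbar :: real
  cubar :: real

definition omegabar :: "profile \<Rightarrow> field" where
  "omegabar P = (\<lambda>x. - elliptic (psibar P) x)"

definition raw_residual_u :: "profile \<Rightarrow> field" where
  "raw_residual_u P = (\<lambda>(r, z).
     - (lam * r + vel_r (psibar P) (r, z)) * dr (ubar P) (r, z)
     - (lam * z + Cbar P + vel_z (psibar P) (r, z)) * dz (ubar P) (r, z)
     + 2 * ubar P (r, z) * dz (psibar P) (r, z)
     + cubar P * ubar P (r, z))"

definition raw_residual_omega :: "profile \<Rightarrow> field" where
  "raw_residual_omega P = (\<lambda>(r, z).
     - (lam * r + vel_r (psibar P) (r, z)) * dr (omegabar P) (r, z)
     - (lam * z + Cbar P + vel_z (psibar P) (r, z)) * dz (omegabar P) (r, z)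
     + 2 * ubar P (r, z) * dz (ubar P) (r, z)
     + (cubar P - lam) * omegabar P (r, z))"

definition cures :: "profile \<Rightarrow> real" where
  "cures P = - raw_residual_u P (0, 0) / ubar P (0, 0)"

definition residual_u :: "profile \<Rightarrow> field" where
  "residual_u P = (\<lambda>x. raw_residual_u P x + cures P * ubar P x)"

definition residual_omega :: "profile \<Rightarrow> field" where
  "residual_omega P = (\<lambda>x. raw_residual_omega P x + cures P * omegabar P x)"

text \<open>
  The regularity is what makes the \<open>k\<close>-th order derivatives of the linearized and residual
  terms below classical: they involve \<open>k + 2\<close> derivatives of \<open>ubar\<close> and \<open>k + 1\<close> derivatives
  of \<open>omegabar\<close>.
\<close>

definition profile_ok :: "nat \<Rightarrow> profile \<Rightarrow> bool" where
  "profile_ok k P \<longleftrightarrow>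
     Ck_on (k + 2) (ubar P) UNIV \<and> Ck_on (k + 3) (psibar P) UNIV \<and> even_r (psibar P) \<and>
     Cbar P + 2 * psibar P (0, 0) = 0 \<and> ubar P (0, 0) \<noteq> 0"


section \<open>Perturbations and operators\<close>

record perturbation =
  du :: field
  domega :: field
  dpsi :: field
  dC :: real
  dcu :: real

definition perturbation_constraints :: "perturbation \<Rightarrow> bool" where
  "perturbation_constraints d \<longleftrightarrow>
     (\<forall>x. - elliptic (dpsi d) x = domega d x) \<and>
     du d (0, 0) = 0 \<and>
     dC d = - 2 * dpsi d (0, 0) \<and>
     dcu d = - 2 * dz (dpsi d) (0, 0)"

definition lin_u :: "profile \<Rightarrow> perturbation \<Rightarrow> field" where
  "lin_u P d = (\<lambda>(r, z).
     (2 * dz (psibar P) (r, z) + cubar P + cures P) * du d (r, z)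
     - (lam * r + vel_r (psibar P) (r, z)) * dr (du d) (r, z)
     - (lam * z + Cbar P + vel_z (psibar P) (r, z)) * dz (du d) (r, z)
     + (2 * ubar P (r, z) + r * dr (ubar P) (r, z)) * dz (dpsi d) (r, z)
     - r * dz (ubar P) (r, z) * dr (dpsi d) (r, z)
     - 2 * dz (ubar P) (r, z) * dpsi d (r, z)
     - dz (ubar P) (r, z) * dC d
     + ubar P (r, z) * dcu d)"

definition lin_omega :: "profile \<Rightarrow> perturbation \<Rightarrow> field" where
  "lin_omega P d = (\<lambda>(r, z).
     (cubar P + cures P - lam) * domega d (r, z)
     - (lam * r + vel_r (psibar P) (r, z)) * dr (domega d) (r, z)
     - (lam * z + Cbar P + vel_z (psibar P) (r, z)) * dz (domega d) (r, z)
     + 2 * dz (ubar P) (r, z) * du d (r, z)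
     + 2 * ubar P (r, z) * dz (du d) (r, z)
     - 2 * dz (omegabar P) (r, z) * dpsi d (r, z)
     + r * dr (omegabar P) (r, z) * dz (dpsi d) (r, z)
     - r * dz (omegabar P) (r, z) * dr (dpsi d) (r, z)
     - dz (omegabar P) (r, z) * dC d
     + omegabar P (r, z) * dcu d)"

definition nonlin_u :: "perturbation \<Rightarrow> field" where
  "nonlin_u d = (\<lambda>(r, z).
     r * dz (dpsi d) (r, z) * dr (du d) (r, z)
     - (dC d + 2 * dpsi d (r, z) + r * dr (dpsi d) (r, z)) * dz (du d) (r, z)
     + 2 * du d (r, z) * dz (dpsi d) (r, z)
     + dcu d * du d (r, z))"

definition nonlin_omega :: "perturbation \<Rightarrow> field" where
  "nonlin_omega d = (\<lambda>(r, z).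
     - vel_r (dpsi d) (r, z) * dr (domega d) (r, z)
     - (dC d + vel_z (dpsi d) (r, z)) * dz (domega d) (r, z)
     + 2 * du d (r, z) * dz (du d) (r, z)
     + dcu d * domega d (r, z))"

datatype component = I\<omega> | Ir | Iz

definition components :: "component set" where
  "components = {I\<omega>, Ir, Iz}"

fun dv :: "component \<Rightarrow> perturbation \<Rightarrow> field" where
  "dv I\<omega> d = domega d"
| "dv Ir d = dr (du d)"
| "dv Iz d = dz (du d)"

fun lin :: "profile \<Rightarrow> component \<Rightarrow> perturbation \<Rightarrow> field" where
  "lin P I\<omega> d = lin_omega P d"
| "lin P Ir d = dr (lin_u P d)"
| "lin P Iz d = dz (lin_u P d)"

fun nonlin :: "component \<Rightarrow> perturbation \<Rightarrow> field" where
  "nonlin I\<omega> d = nonlin_omega d"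
| "nonlin Ir d = dr (nonlin_u d)"
| "nonlin Iz d = dz (nonlin_u d)"

fun residual :: "profile \<Rightarrow> component \<Rightarrow> field" where
  "residual P I\<omega> = residual_omega P"
| "residual P Ir = dr (residual_u P)"
| "residual P Iz = dz (residual_u P)"


section \<open>Weights and energies\<close>

definition pairing :: "field \<Rightarrow> field \<Rightarrow> field \<Rightarrow> real" where
  "pairing \<phi> f g = (LINT x:half_plane|lebesgue. f x * g x * \<phi> x)"

definition pairing_finite :: "field \<Rightarrow> field \<Rightarrow> field \<Rightarrow> bool" where
  "pairing_finite \<phi> f g \<longleftrightarrow> set_integrable lebesgue half_plane (\<lambda>x. f x * g x * \<phi> x)"

definition wnorm :: "field \<Rightarrow> field \<Rightarrow> real" where
  "wnorm \<phi> f = sqrt (pairing \<phi> f f)"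

definition rho :: field where
  "rho = (\<lambda>(r, z). r\<^sup>2 + z\<^sup>2)"

text \<open>The value of a weight at the origin is immaterial, as it affects no integral.\<close>

definition weights_ok :: "(component \<Rightarrow> field) \<Rightarrow> bool" where
  "weights_ok \<Phi> \<longleftrightarrow>
     (\<forall>i. (\<forall>x\<in>half_plane. \<Phi> i x > 0) \<and>
          (\<exists>c>0. AE x in lebesgue. x \<in> half_plane \<longrightarrow> \<Phi> i x \<ge> c) \<and>
          (\<forall>K. compact K \<and> K \<subseteq> half_plane \<longrightarrow> set_integrable lebesgue K (\<Phi> i)) \<and>
          (\<exists>G. continuous_on (half_plane - {(0, 0)}) G \<and>
               (\<forall>x\<in>half_plane - {(0, 0)}.
                  (\<Phi> i has_derivative (\<lambda>h. G x \<bullet> h)) (at x within half_plane)))) \<and>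
     (\<exists>c>0. \<exists>M. \<forall>x\<in>half_plane. rho x \<ge> M \<longrightarrow> min (\<Phi> Ir x) (\<Phi> Iz x) \<ge> c * rho x)"

definition weight_k :: "(component \<Rightarrow> field) \<Rightarrow> nat \<Rightarrow> component \<Rightarrow> field" where
  "weight_k \<Phi> k i = (\<lambda>x. 1 + rho x ^ k * \<Phi> i x)"

definition energy_0 :: "(component \<Rightarrow> field) \<Rightarrow> perturbation \<Rightarrow> real" where
  "energy_0 \<Phi> d = sqrt (\<Sum>i\<in>components. (wnorm (\<Phi> i) (dv i d))\<^sup>2)"

definition energy_high :: "(component \<Rightarrow> field) \<Rightarrow> nat \<Rightarrow> perturbation \<Rightarrow> real" where
  "energy_high \<Phi> k d =
     sqrt (\<Sum>i\<in>components. \<Sum>\<alpha>\<in>multi_indices k. (wnorm (weight_k \<Phi> k i) (partial \<alpha> (dv i d)))\<^sup>2)"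

definition energy :: "(component \<Rightarrow> field) \<Rightarrow> nat \<Rightarrow> real \<Rightarrow> perturbation \<Rightarrow> real" where
  "energy \<Phi> k \<mu> d = sqrt ((energy_0 \<Phi> d)\<^sup>2 + \<mu> * (energy_high \<Phi> k d)\<^sup>2)"


section \<open>Admissible perturbations and solutions\<close>

definition admissible :: "profile \<Rightarrow> (component \<Rightarrow> field) \<Rightarrow> nat \<Rightarrow> perturbation \<Rightarrow> bool" where
  "admissible P \<Phi> k d \<longleftrightarrow>
     perturbation_constraints d \<and>
     (\<forall>f\<in>{du d, domega d, dpsi d}. even_r f \<and> (f \<longlongrightarrow> 0) at_infinity) \<and>
     Ck_on (k + 2) (du d) UNIV \<and> Ck_on (k + 1) (domega d) UNIV \<and> Ck_on (k + 3) (dpsi d) UNIV \<and>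
     (\<forall>i. \<forall>f\<in>{dv i d, lin P i d, nonlin i d, residual P i}.
        pairing_finite (\<Phi> i) f (dv i d) \<and>
        (\<forall>\<alpha>\<in>multi_indices k.
           pairing_finite (weight_k \<Phi> k i) (partial \<alpha> f) (partial \<alpha> (dv i d))))"

definition time_deriv :: "(real \<Rightarrow> field) \<Rightarrow> real \<Rightarrow> field" where
  "time_deriv F t = (\<lambda>x. deriv (\<lambda>s. F s x) t)"

definition energy_identity ::
  "(component \<Rightarrow> field) \<Rightarrow> nat \<Rightarrow> real \<Rightarrow> ereal \<Rightarrow> (real \<Rightarrow> perturbation) \<Rightarrow> bool" where
  "energy_identity \<Phi> k \<mu> T \<delta> \<longleftrightarrow>
     continuous_on {t. 0 \<le> t \<and> ereal t < T} (\<lambda>t. (energy \<Phi> k \<mu> (\<delta> t))\<^sup>2) \<and>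
     (\<forall>t. 0 < t \<and> ereal t < T \<longrightarrow>
        (\<lambda>s. (energy \<Phi> k \<mu> (\<delta> s))\<^sup>2) differentiable (at t) \<and>
        1 / 2 * deriv (\<lambda>s. (energy \<Phi> k \<mu> (\<delta> s))\<^sup>2) t =
          (\<Sum>i\<in>components.
             pairing (\<Phi> i) (time_deriv (\<lambda>s. dv i (\<delta> s)) t) (dv i (\<delta> t)))
          + \<mu> * (\<Sum>i\<in>components. \<Sum>\<alpha>\<in>multi_indices k.
             pairing (weight_k \<Phi> k i)
               (partial \<alpha> (time_deriv (\<lambda>s. dv i (\<delta> s)) t)) (partial \<alpha> (dv i (\<delta> t)))))"

definition solves :: "profile \<Rightarrow> ereal \<Rightarrow> (real \<Rightarrow> perturbation) \<Rightarrow> bool" where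
  "solves P T \<delta> \<longleftrightarrow>
     (\<forall>t. 0 < t \<and> ereal t < T \<longrightarrow> (\<forall>x\<in>half_plane.
        ((\<lambda>s. domega (\<delta> s) x) has_real_derivative
           lin_omega P (\<delta> t) x + nonlin_omega (\<delta> t) x + residual_omega P x) (at t) \<and>
        ((\<lambda>s. dr (du (\<delta> s)) x) has_real_derivative
           dr (lin_u P (\<delta> t)) x + dr (nonlin_u (\<delta> t)) x + dr (residual_u P) x) (at t) \<and>
        ((\<lambda>s. dz (du (\<delta> s)) x) has_real_derivative
           dz (lin_u P (\<delta> t)) x + dz (nonlin_u (\<delta> t)) x + dz (residual_u P) x) (at t)))"

definition admissible_solution ::
  "profile \<Rightarrow> (component \<Rightarrow> field) \<Rightarrow> nat \<Rightarrow> real \<Rightarrow> ereal \<Rightarrow> (real \<Rightarrow> perturbation) \<Rightarrow> bool" where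
  "admissible_solution P \<Phi> k \<mu> T \<delta> \<longleftrightarrow>
     (\<forall>t. 0 \<le> t \<and> ereal t < T \<longrightarrow> admissible P \<Phi> k (\<delta> t)) \<and>
     solves P T \<delta> \<and> energy_identity \<Phi> k \<mu> T \<delta>"

end

theory Submission
  imports Defs
begin

text \<open>
  Along the solution, the energy identity and the estimates give
  \<open>E * E' \<le> - \<Lambda>stab * E^2 + \<Lambda>3 * E^3 + \<Lambda>R * E\<close>. At \<open>E = \<delta>star\<close> the right-hand side is
  \<open>\<delta>star^2 * (\<Lambda>3 * \<delta>star + \<Lambda>R / \<delta>star - \<Lambda>stab) < 0\<close>, so \<open>E^2\<close> is strictly decreasing whenever
  it meets the level \<open>\<delta>star^2\<close> and hence cannot reach it from below.

  Splitting \<open>D^\<alpha>\<close> of the time derivative into its linear, nonlinear and residual parts requires these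
  parts to be of class \<open>C^k\<close>. This is needed only on the open set \<open>r > 0\<close>, where \<open>3 / r\<close> is smooth,
  since the axis is a null set for the pairings.
\<close>

section \<open>Locality of \<open>dr\<close>, \<open>dz\<close> and \<open>Ck_on\<close> on open
  sets\<close>

lemma eventually_nhds_slice_fst:
  fixes S :: "(real \<times> real) set"
  assumes "open S" "(r, z) \<in> S"
  shows "\<forall>\<^sub>F s in nhds r. (s, z) \<in> S"
proof -
  have "open ((\<lambda>s. (s, z)) -` S)"
    using assms(1) by (rule open_vimage) (simp add: continuous_on_Pair)
  then show ?thesis
    using eventually_nhds_in_open[of "(\<lambda>s. (s, z)) -` S" r] assms(2) by simp
qed

lemma eventually_nhds_slice_snd:
  fixes S :: "(real \<times> real) set"
  assumes "open S" "(r, z) \<in> S"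
  shows "\<forall>\<^sub>F s in nhds z. (r, s) \<in> S"
proof -
  have "open ((\<lambda>s. (r, s)) -` S)"
    using assms(1) by (rule open_vimage) (simp add: continuous_on_Pair)
  then show ?thesis
    using eventually_nhds_in_open[of "(\<lambda>s. (r, s)) -` S" z] assms(2) by simp
qed

text \<open>Openness of \<open>S\<close> makes the horizontal slice through \<open>x\<close> a
  neighbourhood of its \<open>r\<close>-coordinate, and \<open>deriv\<close> sees only such a
  neighbourhood.\<close>

lemma dr_cong:
  assumes "open S" "\<And>x. x \<in> S \<Longrightarrow> f x = g x" "x \<in> S"
  shows "dr f x = dr g x"
proof (cases x)
  case (Pair r z)
  then have "\<forall>\<^sub>F s in nhds r. f (s, z) = g (s, z)"
    using eventually_nhds_slice_fst[of S r z] assms by (auto elim: eventually_mono)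
  then show ?thesis
    unfolding dr_def Pair by (simp add: deriv_cong_ev)
qed

lemma dz_cong:
  assumes "open S" "\<And>x. x \<in> S \<Longrightarrow> f x = g x" "x \<in> S"
  shows "dz f x = dz g x"
proof (cases x)
  case (Pair r z)
  then have "\<forall>\<^sub>F s in nhds z. f (r, s) = g (r, s)"
    using eventually_nhds_slice_snd[of S r z] assms by (auto elim: eventually_mono)
  then show ?thesis
    unfolding dz_def Pair by (simp add: deriv_cong_ev)
qed

lemma differentiable_cong_ev:
  fixes f g :: "real \<Rightarrow> real"
  assumes "\<forall>\<^sub>F s in nhds a. f s = g s"
  shows "f differentiable (at a) \<longleftrightarrow> g differentiable (at a)"
  using DERIV_cong_ev[OF refl assms refl] by (simp add: real_differentiable_def)

text \<open>This lets a function be replaced by a formula valid only on \<open>S\<close>, as happens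
  for \<open>elliptic\<close> off the axis. Openness is essential: agreement on \<open>S\<close>
  must pass to the derivatives at each step of the induction.\<close>

lemma Ck_on_cong:
  assumes "open S" "\<And>x. x \<in> S \<Longrightarrow> f x = g x"
  shows "Ck_on n f S \<longleftrightarrow> Ck_on n g S"
  using assms(2)
proof (induction n arbitrary: f g)
  case 0
  then show ?case by (simp cong: continuous_on_cong)
next
  case (Suc n)
  have "(\<lambda>s. f (s, z)) differentiable (at r) \<longleftrightarrow> (\<lambda>s. g (s, z)) differentiable (at r)"
    and "(\<lambda>s. f (r, s)) differentiable (at z) \<longleftrightarrow> (\<lambda>s. g (r, s)) differentiable (at z)"
    if "(r, z) \<in> S" for r z
    using eventually_nhds_slice_fst[OF assms(1) that] eventually_nhds_slice_snd[OF assms(1) that]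
      Suc.prems by (auto intro!: differentiable_cong_ev elim: eventually_mono)
  moreover have "Ck_on n (dr f) S \<longleftrightarrow> Ck_on n (dr g) S" "Ck_on n (dz f) S \<longleftrightarrow> Ck_on n (dz g) S"
    using dr_cong dz_cong assms(1) Suc.prems by (blast intro!: Suc.IH)+
  moreover have "continuous_on S f \<longleftrightarrow> continuous_on S g"
    using Suc.prems by (simp cong: continuous_on_cong)
  ultimately show ?case by auto
qed

section \<open>Closure properties of the classes \<open>Ck_on\<close>\<close>

lemma Ck_on_subset: "Ck_on n f S \<Longrightarrow> S' \<subseteq> S \<Longrightarrow> Ck_on n f S'"
  by (induction n arbitrary: f) (auto intro: continuous_on_subset)

lemma Ck_on_imp_continuous_on: "Ck_on n f S \<Longrightarrow> continuous_on S f"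
  by (cases n) auto

lemma Ck_on_SucD: "Ck_on (Suc n) f S \<Longrightarrow> Ck_on n f S"
proof (induction n arbitrary: f)
  case (Suc n)
  then have "Ck_on n (dr f) S" "Ck_on n (dz f) S"
    using Ck_on.simps(2)[of "Suc n" f S] by blast+
  with Suc.prems show ?case
    using Ck_on.simps(2)[of n f S] Ck_on.simps(2)[of "Suc n" f S] by blast
qed simp

lemma Ck_on_le:
  assumes "Ck_on n f S" "m \<le> n"
  shows "Ck_on m f S"
  using assms(2,1) by (induction rule: inc_induct) (blast intro: Ck_on_SucD)+

lemma Ck_on_dr: "Ck_on (Suc n) f S \<Longrightarrow> Ck_on n (dr f) S"
  by auto

lemma Ck_on_dz: "Ck_on (Suc n) f S \<Longrightarrow> Ck_on n (dz f) S"
  by auto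

lemma Ck_on_has_deriv_r:
  assumes "Ck_on (Suc n) f S" "(r, z) \<in> S"
  shows "((\<lambda>s. f (s, z)) has_real_derivative dr f (r, z)) (at r)"
  using assms by (auto simp: dr_def DERIV_deriv_iff_real_differentiable)

lemma Ck_on_has_deriv_z:
  assumes "Ck_on (Suc n) f S" "(r, z) \<in> S"
  shows "((\<lambda>s. f (r, s)) has_real_derivative dz f (r, z)) (at z)"
  using assms by (auto simp: dz_def DERIV_deriv_iff_real_differentiable)

text \<open>Explicit candidates \<open>fr\<close> and \<open>fz\<close> stand in for
  \<open>dr f\<close> and \<open>dz f\<close>, so closure proofs can apply their induction
  hypothesis to sums and products instead of terms in \<open>deriv\<close>. By uniqueness of
  derivatives the candidates agree with \<open>dr f\<close> and \<open>dz f\<close> on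
  \<open>S\<close>.\<close>

lemma Ck_on_SucI:
  assumes "open S" "continuous_on S f"
    and r: "\<And>r z. (r, z) \<in> S \<Longrightarrow> ((\<lambda>s. f (s, z)) has_real_derivative fr (r, z)) (at r)"
    and z: "\<And>r z. (r, z) \<in> S \<Longrightarrow> ((\<lambda>s. f (r, s)) has_real_derivative fz (r, z)) (at z)"
    and "Ck_on n fr S" "Ck_on n fz S"
  shows "Ck_on (Suc n) f S"
proof -
  have "dr f x = fr x" "dz f x = fz x" if "x \<in> S" for x
    using r z that by (cases x; auto simp: dr_def dz_def intro!: DERIV_imp_deriv)+
  then have "Ck_on n (dr f) S" "Ck_on n (dz f) S"
    using Ck_on_cong[OF \<open>open S\<close>, of "dr f" fr] Ck_on_cong[OF \<open>open S\<close>, of "dz f" fz] assms(5,6)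
    by simp_all
  moreover have "(\<lambda>s. f (s, z)) differentiable (at r) \<and> (\<lambda>s. f (r, s)) differentiable (at z)"
    if "(r, z) \<in> S" for r z
    using r[OF that] z[OF that] unfolding real_differentiable_def by blast
  ultimately show ?thesis
    using assms(2) by auto
qed

lemma Ck_on_const: "open S \<Longrightarrow> Ck_on n (\<lambda>x. c) S"
proof (induction n arbitrary: c)
  case (Suc n)
  then show ?case
    by (intro Ck_on_SucI[where fr = "\<lambda>x. 0" and fz = "\<lambda>x. 0"]) auto
qed auto

lemma Ck_on_fst: "open S \<Longrightarrow> Ck_on n fst S"
  by (cases n) (auto simp del: Ck_on.simps(2) intro!: continuous_intros Ck_on_const
      Ck_on_SucI[where fr = "\<lambda>x. 1" and fz = "\<lambda>x. 0"])

lemma Ck_on_snd: "open S \<Longrightarrow> Ck_on n snd S"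
  by (cases n) (auto simp del: Ck_on.simps(2) intro!: continuous_intros Ck_on_const
      Ck_on_SucI[where fr = "\<lambda>x. 0" and fz = "\<lambda>x. 1"])

lemma Ck_on_add:
  assumes "open S" "Ck_on n f S" "Ck_on n g S"
  shows "Ck_on n (\<lambda>x. f x + g x) S"
  using assms(2,3)
proof (induction n arbitrary: f g)
  case (Suc n)
  show ?case
    by (rule Ck_on_SucI[OF \<open>open S\<close>, where fr = "\<lambda>x. dr f x + dr g x" and fz = "\<lambda>x. dz f x + dz g x"])
      (use Suc in \<open>auto intro!: continuous_intros DERIV_add Ck_on_has_deriv_r Ck_on_has_deriv_z
        Suc.IH simp del: Ck_on.simps intro: Ck_on_imp_continuous_on Ck_on_dr Ck_on_dz\<close>)
qed (auto intro: continuous_intros)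

lemma Ck_on_mult:
  assumes "open S" "Ck_on n f S" "Ck_on n g S"
  shows "Ck_on n (\<lambda>x. f x * g x) S"
  using assms(2,3)
proof (induction n arbitrary: f g)
  case (Suc n)
  show ?case
  proof (rule Ck_on_SucI[OF \<open>open S\<close>, where fr = "\<lambda>x. dr f x * g x + dr g x * f x"
        and fz = "\<lambda>x. dz f x * g x + dz g x * f x"])
    show "continuous_on S (\<lambda>x. f x * g x)"
      using Suc.prems by (auto intro!: continuous_intros)
    \<comment> \<open>The product rule pairs a derivative, of class \<open>n\<close>, with an
      undifferentiated factor of class \<open>Suc n\<close>; \<open>Ck_on_SucD\<close> lowers the
      latter so that the induction hypothesis covers both products.\<close>
    show "Ck_on n (\<lambda>x. dr f x * g x + dr g x * f x) S" "Ck_on n (\<lambda>x. dz f x * g x + dz g x * f x) S"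
      using Suc.prems by (auto intro!: Ck_on_add \<open>open S\<close> Suc.IH Ck_on_dr Ck_on_dz
          simp del: Ck_on.simps dest: Ck_on_SucD)
  qed (auto intro!: DERIV_mult Ck_on_has_deriv_r[OF Suc.prems(1)] Ck_on_has_deriv_r[OF Suc.prems(2)]
      Ck_on_has_deriv_z[OF Suc.prems(1)] Ck_on_has_deriv_z[OF Suc.prems(2)] simp del: Ck_on.simps)
qed (auto intro: continuous_intros)

lemma Ck_on_minus:
  assumes "open S" "Ck_on n f S"
  shows "Ck_on n (\<lambda>x. - f x) S"
  using Ck_on_mult[OF assms(1) Ck_on_const[OF assms(1), of n "-1"] assms(2)] by simp

lemma Ck_on_diff:
  assumes "open S" "Ck_on n f S" "Ck_on n g S"
  shows "Ck_on n (\<lambda>x. f x - g x) S"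
  using Ck_on_add[OF assms(1,2) Ck_on_minus[OF assms(1,3)]] by simp

section \<open>The open right half-plane and the elliptic operator\<close>

definition right_half_plane :: "(real \<times> real) set" where
  "right_half_plane = {x. fst x > 0}"

lemma open_right_half_plane: "open right_half_plane"
  unfolding right_half_plane_def by (intro open_Collect_less continuous_intros)

text \<open>The derivative of \<open>1 / r\<close> is minus the square of the same function, so the
  induction hypothesis and closure under products suffice.\<close>

lemma Ck_on_inverse_fst: "Ck_on n (\<lambda>x. inverse (fst x)) right_half_plane"
proof (induction n)
  case 0
  show ?case
    by (auto simp: right_half_plane_def intro!: continuous_intros)
next
  case (Suc n)
  show ?case
  proof (rule Ck_on_SucI[OF open_right_half_plane,
        where fr = "\<lambda>x. - (inverse (fst x) * inverse (fst x))" and fz = "\<lambda>x. 0"])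
    show "continuous_on right_half_plane (\<lambda>x. inverse (fst x))"
      by (auto simp: right_half_plane_def intro!: continuous_intros)
    show "Ck_on n (\<lambda>x. - (inverse (fst x) * inverse (fst x))) right_half_plane"
      by (intro Ck_on_minus Ck_on_mult open_right_half_plane Suc)
  qed (auto simp: right_half_plane_def divide_inverse
      intro!: Ck_on_const open_right_half_plane[unfolded right_half_plane_def] derivative_eq_intros)
qed

text \<open>Off the axis the case distinction in \<open>elliptic\<close> disappears and the
  coefficient \<open>3 / r\<close> is smooth. Only the two second derivatives lower the
  order.\<close>

lemma Ck_on_elliptic:
  assumes "Ck_on (n + 2) f right_half_plane"
  shows "Ck_on n (elliptic f) right_half_plane"
proof -
  have *: "Ck_on (Suc (Suc n)) f right_half_plane"
    using assms by simp
  have "Ck_on n (\<lambda>x. dr (dr f) x + 3 * inverse (fst x) * dr f x + dz (dz f) x) right_half_plane"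
    using * by (auto intro!: Ck_on_add Ck_on_mult Ck_on_const Ck_on_inverse_fst
        open_right_half_plane simp del: Ck_on.simps intro: Ck_on_dr Ck_on_dz dest: Ck_on_SucD)
  then show ?thesis
    by (subst Ck_on_cong[OF open_right_half_plane, where
          g = "\<lambda>x. dr (dr f) x + 3 * inverse (fst x) * dr f x + dz (dz f) x"])
      (auto simp: elliptic_def right_half_plane_def divide_inverse)
qed

section \<open>Locality and additivity of iterated derivatives\<close>

lemma funpow_cong_on:
  assumes D: "D \<in> {dr, dz}" and "open S" and "\<And>x. x \<in> S \<Longrightarrow> f x = g x" "x \<in> S"
  shows "(D ^^ m) f x = (D ^^ m) g x"
  using assms(3,4)
proof (induction m arbitrary: x)
  case (Suc m)
  then have "(D ^^ m) f y = (D ^^ m) g y" if "y \<in> S" for y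
    using that by blast
  then show ?case
    using D dr_cong[OF \<open>open S\<close>, of "(D ^^ m) f" "(D ^^ m) g" x] Suc.prems(2)
      dz_cong[OF \<open>open S\<close>, of "(D ^^ m) f" "(D ^^ m) g" x] by auto
qed auto

lemma Ck_on_funpow:
  assumes "D \<in> {dr, dz}"
  shows "Ck_on (n + m) f S \<Longrightarrow> Ck_on n ((D ^^ m) f) S"
proof (induction m arbitrary: n)
  case (Suc m)
  then have "Ck_on (Suc n) ((D ^^ m) f) S"
    using Suc.IH[of "Suc n"] by simp
  then show ?case
    using assms by auto
qed auto

text \<open>\<open>deriv\<close> is additive only where both derivatives exist, hence the regularity
  assumptions. The induction proves additivity at order \<open>m\<close> on all of \<open>S\<close>,
  so that this identity may itself be differentiated; at that stage both iterates are still of class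
  one.\<close>

lemma funpow_add_on:
  assumes D: "D \<in> {dr, dz}" and "open S" and "Ck_on m f S" "Ck_on m g S" "x \<in> S"
  shows "(D ^^ m) (\<lambda>x. f x + g x) x = (D ^^ m) f x + (D ^^ m) g x"
  using assms(3-5)
proof (induction m arbitrary: x)
  case (Suc m)
  have IH: "(D ^^ m) (\<lambda>x. f x + g x) y = (D ^^ m) f y + (D ^^ m) g y" if "y \<in> S" for y
    using Suc that by (auto intro!: Suc.IH simp del: Ck_on.simps dest: Ck_on_SucD)
  have C: "Ck_on (Suc 0) ((D ^^ m) f) S" "Ck_on (Suc 0) ((D ^^ m) g) S"
    using Suc.prems Ck_on_funpow[OF D, of "Suc 0" m] by auto
  obtain r z where x: "x = (r, z)" by fastforce
  note d = DERIV_add[OF Ck_on_has_deriv_r[OF C(1)] Ck_on_has_deriv_r[OF C(2)], of r z]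
    DERIV_add[OF Ck_on_has_deriv_z[OF C(1)] Ck_on_has_deriv_z[OF C(2)], of r z]
  have "D ((D ^^ m) (\<lambda>x. f x + g x)) x = D (\<lambda>x. (D ^^ m) f x + (D ^^ m) g x) x"
    using D dr_cong[OF \<open>open S\<close> IH Suc.prems(3)] dz_cong[OF \<open>open S\<close> IH Suc.prems(3)] by auto
  also have "\<dots> = D ((D ^^ m) f) x + D ((D ^^ m) g) x"
    using D d[THEN DERIV_imp_deriv] Suc.prems(3) unfolding x by (auto simp: dr_def dz_def)
  finally show ?case by simp
qed auto

lemma partial_cong:
  assumes "open S" "\<And>x. x \<in> S \<Longrightarrow> f x = g x" "x \<in> S"
  shows "partial \<alpha> f x = partial \<alpha> g x"
  unfolding partial_def using assms by (intro funpow_cong_on[of _ S]) auto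

text \<open>The \<open>z\<close>-derivatives are applied first and use up
  \<open>snd \<alpha>\<close> orders of regularity; the remaining \<open>fst \<alpha>\<close> orders
  are exactly what the \<open>r\<close>-derivatives need.\<close>

lemma partial_add:
  assumes "open S" "fst \<alpha> + snd \<alpha> = n" "Ck_on n f S" "Ck_on n g S" "x \<in> S"
  shows "partial \<alpha> (\<lambda>x. f x + g x) x = partial \<alpha> f x + partial \<alpha> g x"
proof -
  have C: "Ck_on (fst \<alpha>) ((dz ^^ snd \<alpha>) f) S" "Ck_on (fst \<alpha>) ((dz ^^ snd \<alpha>) g) S"
    using assms by (auto intro!: Ck_on_funpow)
  have C': "Ck_on (snd \<alpha>) f S" "Ck_on (snd \<alpha>) g S"
    using assms by (auto intro: Ck_on_le)
  have "partial \<alpha> (\<lambda>x. f x + g x) x = (dr ^^ fst \<alpha>) (\<lambda>x. (dz ^^ snd \<alpha>) f x + (dz ^^ snd \<alpha>) g x) x"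
    unfolding partial_def using assms(1,5) C' by (intro funpow_cong_on[of _ S] funpow_add_on[of _ S]) auto
  also have "\<dots> = partial \<alpha> f x + partial \<alpha> g x"
    unfolding partial_def using C assms(1,5) by (intro funpow_add_on[of _ S]) auto
  finally show ?thesis .
qed

section \<open>Regularity of the linear, nonlinear and residual terms\<close>

lemmas Ck_on_right_half_plane_intros =
  Ck_on_add[OF open_right_half_plane] Ck_on_diff[OF open_right_half_plane]
  Ck_on_mult[OF open_right_half_plane] Ck_on_minus[OF open_right_half_plane]
  Ck_on_const[OF open_right_half_plane] Ck_on_fst[OF open_right_half_plane]
  Ck_on_snd[OF open_right_half_plane]

lemma Ck_on_lin_u:
  assumes "Ck_on (Suc n) (ubar P) right_half_plane" "Ck_on (Suc n) (psibar P) right_half_plane"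
    "Ck_on (Suc n) (du d) right_half_plane" "Ck_on (Suc n) (dpsi d) right_half_plane"
  shows "Ck_on n (lin_u P d) right_half_plane"
  unfolding lin_u_def vel_r_def vel_z_def case_prod_unfold fst_conv snd_conv prod.collapse
  by (intro Ck_on_right_half_plane_intros assms[THEN Ck_on_SucD] assms[THEN Ck_on_dr]
      assms[THEN Ck_on_dz])

lemma Ck_on_lin_omega:
  assumes "Ck_on (Suc n) (ubar P) right_half_plane" "Ck_on (Suc n) (psibar P) right_half_plane"
    "Ck_on (Suc n) (omegabar P) right_half_plane" "Ck_on (Suc n) (du d) right_half_plane"
    "Ck_on (Suc n) (dpsi d) right_half_plane" "Ck_on (Suc n) (domega d) right_half_plane"
  shows "Ck_on n (lin_omega P d) right_half_plane"
  unfolding lin_omega_def vel_r_def vel_z_def case_prod_unfold fst_conv snd_conv prod.collapse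
  by (intro Ck_on_right_half_plane_intros assms[THEN Ck_on_SucD] assms[THEN Ck_on_dr]
      assms[THEN Ck_on_dz])

lemma Ck_on_nonlin_u:
  assumes "Ck_on (Suc n) (du d) right_half_plane" "Ck_on (Suc n) (dpsi d) right_half_plane"
  shows "Ck_on n (nonlin_u d) right_half_plane"
  unfolding nonlin_u_def case_prod_unfold fst_conv snd_conv prod.collapse
  by (intro Ck_on_right_half_plane_intros assms[THEN Ck_on_SucD] assms[THEN Ck_on_dr]
      assms[THEN Ck_on_dz])

lemma Ck_on_nonlin_omega:
  assumes "Ck_on (Suc n) (du d) right_half_plane" "Ck_on (Suc n) (dpsi d) right_half_plane"
    "Ck_on (Suc n) (domega d) right_half_plane"
  shows "Ck_on n (nonlin_omega d) right_half_plane"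
  unfolding nonlin_omega_def vel_r_def vel_z_def case_prod_unfold fst_conv snd_conv prod.collapse
  by (intro Ck_on_right_half_plane_intros assms[THEN Ck_on_SucD] assms[THEN Ck_on_dr]
      assms[THEN Ck_on_dz])

lemma Ck_on_residual_u:
  assumes "Ck_on (Suc n) (ubar P) right_half_plane" "Ck_on (Suc n) (psibar P) right_half_plane"
  shows "Ck_on n (residual_u P) right_half_plane"
  unfolding residual_u_def raw_residual_u_def vel_r_def vel_z_def case_prod_unfold fst_conv
    snd_conv prod.collapse
  by (intro Ck_on_right_half_plane_intros assms[THEN Ck_on_SucD] assms[THEN Ck_on_dr]
      assms[THEN Ck_on_dz])

lemma Ck_on_residual_omega:
  assumes "Ck_on (Suc n) (ubar P) right_half_plane" "Ck_on (Suc n) (psibar P) right_half_plane"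
    "Ck_on (Suc n) (omegabar P) right_half_plane"
  shows "Ck_on n (residual_omega P) right_half_plane"
  unfolding residual_omega_def raw_residual_omega_def vel_r_def vel_z_def case_prod_unfold fst_conv
    snd_conv prod.collapse
  by (intro Ck_on_right_half_plane_intros assms[THEN Ck_on_SucD] assms[THEN Ck_on_dr]
      assms[THEN Ck_on_dz])

text \<open>The count of derivatives is as follows. The \<open>Ir\<close> and \<open>Iz\<close>
  components are derivatives of \<open>lin_u\<close>, \<open>nonlin_u\<close> and
  \<open>residual_u\<close>, which must therefore be of class \<open>k + 1\<close> and ask for class
  \<open>k + 2\<close> of their ingredients. The \<open>I\<omega>\<close> components ask for class
  \<open>k + 1\<close>; for \<open>omegabar P\<close> this comes from class \<open>k + 3\<close> of
  \<open>psibar P\<close>.\<close>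

lemma Ck_on_evolution_terms:
  assumes "profile_ok k P" "admissible P \<Phi> k d"
  shows "Ck_on k (lin P i d) right_half_plane"
    and "Ck_on k (nonlin i d) right_half_plane"
    and "Ck_on k (residual P i) right_half_plane"
proof -
  have bar: "Ck_on (Suc (Suc k)) (ubar P) right_half_plane"
      "Ck_on (Suc (Suc (Suc k))) (psibar P) right_half_plane"
    and pert: "Ck_on (Suc (Suc k)) (du d) right_half_plane" "Ck_on (Suc k) (domega d) right_half_plane"
      "Ck_on (Suc (Suc (Suc k))) (dpsi d) right_half_plane"
    using assms Ck_on_subset[of _ _ UNIV right_half_plane] unfolding profile_ok_def admissible_def
    by (simp_all add: numeral_eq_Suc del: Ck_on.simps)
  have "Ck_on (Suc k) (elliptic (psibar P)) right_half_plane"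
    using bar(2) by (intro Ck_on_elliptic) (simp del: Ck_on.simps)
  then have om: "Ck_on (Suc k) (omegabar P) right_half_plane"
    unfolding omegabar_def by (intro Ck_on_minus open_right_half_plane)
  \<comment> \<open>The same functions are needed at several orders, so their lowered versions are
    listed for direct matching.\<close>
  note reg = bar pert om bar[THEN Ck_on_SucD] pert(1,3)[THEN Ck_on_SucD]
    bar(2)[THEN Ck_on_SucD, THEN Ck_on_SucD] pert(3)[THEN Ck_on_SucD, THEN Ck_on_SucD]
  show "Ck_on k (lin P i d) right_half_plane"
    by (cases i; simp only: lin.simps)
      (intro Ck_on_lin_omega Ck_on_dr Ck_on_dz Ck_on_lin_u reg)+
  show "Ck_on k (nonlin i d) right_half_plane"
    by (cases i; simp only: nonlin.simps)
      (intro Ck_on_nonlin_omega Ck_on_dr Ck_on_dz Ck_on_nonlin_u reg)+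
  show "Ck_on k (residual P i) right_half_plane"
    by (cases i; simp only: residual.simps)
      (intro Ck_on_residual_omega Ck_on_dr Ck_on_dz Ck_on_residual_u reg)+
qed

section \<open>Splitting the pairings with the time derivative\<close>

lemma time_deriv_dv:
  assumes "solves P T \<delta>" "0 < t" "ereal t < T" "x \<in> half_plane"
  shows "time_deriv (\<lambda>s. dv i (\<delta> s)) t x = lin P i (\<delta> t) x + nonlin i (\<delta> t) x + residual P i x"
  using assms unfolding solves_def time_deriv_def
  by (cases i) (auto intro!: DERIV_imp_deriv)

text \<open>The two half-planes differ by the axis \<open>r = 0\<close>, a hyperplane with normal
  \<open>(1, 0)\<close> and hence negligible.\<close>

lemma AE_right_half_plane: "AE x in lebesgue. x \<in> half_plane \<longrightarrow> x \<in> right_half_plane"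
proof -
  have "negligible {x :: real \<times> real. (1, 0) \<bullet> x = 0}"
    by (rule negligible_hyperplane) (auto simp: zero_prod_def)
  then show ?thesis
    unfolding eventually_ae_filter_negligible
    by (intro exI[of _ "{x. (1, 0) \<bullet> x = 0}"] conjI) (auto simp: half_plane_def right_half_plane_def)
qed

text \<open>In the application \<open>F\<close> is a time derivative, or a spatial derivative of
  one, whose decomposition is established only off the axis. Agreement almost everywhere is enough
  for the integral.\<close>

lemma pairing_add3:
  assumes F: "\<And>x. x \<in> right_half_plane \<Longrightarrow> F x = f1 x + f2 x + f3 x"
    and fin: "pairing_finite \<phi> f1 g" "pairing_finite \<phi> f2 g" "pairing_finite \<phi> f3 g"
  shows "pairing \<phi> F g = pairing \<phi> f1 g + pairing \<phi> f2 g + pairing \<phi> f3 g"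
proof -
  define w where "w = (\<lambda>f x. f x * g x * \<phi> x)"
  define h where "h = (\<lambda>x. w f1 x + w f2 x + w f3 x)"
  have int: "set_integrable lebesgue half_plane (w f1)" "set_integrable lebesgue half_plane (w f2)"
    "set_integrable lebesgue half_plane (w f3)"
    using fin unfolding pairing_finite_def w_def .
  note int12 = set_integral_add(1)[OF int(1,2)]
  have "set_integrable lebesgue half_plane h"
    unfolding h_def by (rule set_integral_add(1)[OF int12 int(3)])
  then have meas: "(\<lambda>x. indicator half_plane x *\<^sub>R h x) \<in> borel_measurable lebesgue"
    unfolding set_integrable_def by (rule borel_measurable_integrable)
  have "h x = w F x" if "x \<in> right_half_plane" for x
    using F[OF that] by (simp add: h_def w_def algebra_simps)
  then have eq: "AE x in lebesgue. indicator half_plane x *\<^sub>R h x = indicator half_plane x *\<^sub>R w F x"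
    using AE_right_half_plane by (auto elim!: eventually_mono split: split_indicator)
  \<comment> \<open>Measurability of the integrand of \<open>F\<close> is inherited from that of
    \<open>h\<close>: Lebesgue measure is complete, so changing values on a null set is
    harmless.\<close>
  have "pairing \<phi> F g = (LINT x:half_plane|lebesgue. h x)"
    unfolding pairing_def set_lebesgue_integral_def
    by (rule integral_cong_AE[OF meas borel_measurable_AE[OF meas eq] eq, symmetric, unfolded w_def])
  also have "\<dots> = pairing \<phi> f1 g + pairing \<phi> f2 g + pairing \<phi> f3 g"
    unfolding h_def set_integral_add(2)[OF int12 int(3)] set_integral_add(2)[OF int(1,2)]
    by (simp add: pairing_def w_def)
  finally show ?thesis .
qed

text \<open>This brings the right-hand side of the energy identity into the three groups that the
  hypotheses of the theorem estimate. Admissibility supplies finiteness of each separate pairing,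
  without which the integral could not be split.\<close>

lemma pairing_time_deriv_dv:
  assumes "profile_ok k P" "admissible P \<Phi> k (\<delta> t)" "solves P T \<delta>" "0 < t" "ereal t < T"
  shows "pairing (\<Phi> i) (time_deriv (\<lambda>s. dv i (\<delta> s)) t) (dv i (\<delta> t)) =
      pairing (\<Phi> i) (lin P i (\<delta> t)) (dv i (\<delta> t))
      + pairing (\<Phi> i) (nonlin i (\<delta> t)) (dv i (\<delta> t))
      + pairing (\<Phi> i) (residual P i) (dv i (\<delta> t))"
    and "\<alpha> \<in> multi_indices k \<Longrightarrow>
      pairing (weight_k \<Phi> k i) (partial \<alpha> (time_deriv (\<lambda>s. dv i (\<delta> s)) t)) (partial \<alpha> (dv i (\<delta> t))) =
      pairing (weight_k \<Phi> k i) (partial \<alpha> (lin P i (\<delta> t))) (partial \<alpha> (dv i (\<delta> t)))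
      + pairing (weight_k \<Phi> k i) (partial \<alpha> (nonlin i (\<delta> t))) (partial \<alpha> (dv i (\<delta> t)))
      + pairing (weight_k \<Phi> k i) (partial \<alpha> (residual P i)) (partial \<alpha> (dv i (\<delta> t)))"
proof -
  have fin: "pairing_finite (\<Phi> i) f (dv i (\<delta> t)) \<and>
      (\<forall>\<alpha>\<in>multi_indices k. pairing_finite (weight_k \<Phi> k i) (partial \<alpha> f) (partial \<alpha> (dv i (\<delta> t))))"
    if "f \<in> {lin P i (\<delta> t), nonlin i (\<delta> t), residual P i}" for f
    using assms(2) that unfolding admissible_def by blast
  have evol: "time_deriv (\<lambda>s. dv i (\<delta> s)) t x = lin P i (\<delta> t) x + nonlin i (\<delta> t) x + residual P i x"
    if "x \<in> right_half_plane" for x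
    using that by (intro time_deriv_dv[OF assms(3-5)]) (simp add: right_half_plane_def half_plane_def)
  show "pairing (\<Phi> i) (time_deriv (\<lambda>s. dv i (\<delta> s)) t) (dv i (\<delta> t)) =
      pairing (\<Phi> i) (lin P i (\<delta> t)) (dv i (\<delta> t))
      + pairing (\<Phi> i) (nonlin i (\<delta> t)) (dv i (\<delta> t))
      + pairing (\<Phi> i) (residual P i) (dv i (\<delta> t))"
    by (rule pairing_add3[OF evol]) (simp_all add: fin)
  assume \<alpha>: "\<alpha> \<in> multi_indices k"
  then have k: "fst \<alpha> + snd \<alpha> = k"
    by (simp add: multi_indices_def)
  note C = Ck_on_evolution_terms[OF assms(1,2), of i]
  have "partial \<alpha> (time_deriv (\<lambda>s. dv i (\<delta> s)) t) x =
      partial \<alpha> (lin P i (\<delta> t)) x + partial \<alpha> (nonlin i (\<delta> t)) x + partial \<alpha> (residual P i) x"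
    if x: "x \<in> right_half_plane" for x
  proof -
    have "partial \<alpha> (time_deriv (\<lambda>s. dv i (\<delta> s)) t) x =
        partial \<alpha> (\<lambda>x. (lin P i (\<delta> t) x + nonlin i (\<delta> t) x) + residual P i x) x"
      by (rule partial_cong[OF open_right_half_plane evol x])
    also have "\<dots> = partial \<alpha> (\<lambda>x. lin P i (\<delta> t) x + nonlin i (\<delta> t) x) x + partial \<alpha> (residual P i) x"
      by (rule partial_add[OF open_right_half_plane k Ck_on_add[OF open_right_half_plane C(1,2)] C(3) x])
    also have "partial \<alpha> (\<lambda>x. lin P i (\<delta> t) x + nonlin i (\<delta> t) x) x
        = partial \<alpha> (lin P i (\<delta> t)) x + partial \<alpha> (nonlin i (\<delta> t)) x"
      by (rule partial_add[OF open_right_half_plane k C(1,2) x])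
    finally show ?thesis .
  qed
  then show "pairing (weight_k \<Phi> k i) (partial \<alpha> (time_deriv (\<lambda>s. dv i (\<delta> s)) t)) (partial \<alpha> (dv i (\<delta> t))) =
      pairing (weight_k \<Phi> k i) (partial \<alpha> (lin P i (\<delta> t))) (partial \<alpha> (dv i (\<delta> t)))
      + pairing (weight_k \<Phi> k i) (partial \<alpha> (nonlin i (\<delta> t))) (partial \<alpha> (dv i (\<delta> t)))
      + pairing (weight_k \<Phi> k i) (partial \<alpha> (residual P i)) (partial \<alpha> (dv i (\<delta> t)))"
    by (rule pairing_add3) (simp_all add: fin \<alpha>)
qed

section \<open>Energies and the barrier argument\<close>

lemma energy_nonneg: "0 \<le> \<mu> \<Longrightarrow> 0 \<le> energy \<Phi> k \<mu> d"
  by (simp add: energy_def)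

lemma energy_power2: "0 \<le> \<mu> \<Longrightarrow> (energy \<Phi> k \<mu> d)\<^sup>2 = (energy_0 \<Phi> d)\<^sup>2 + \<mu> * (energy_high \<Phi> k d)\<^sup>2"
  unfolding energy_def by (rule real_sqrt_pow2) simp

text \<open>Take the first time at which \<open>y\<close> equals \<open>c\<close>. A negative
  derivative there forces \<open>y\<close> above \<open>c\<close> shortly before, and the
  intermediate value theorem then yields a still earlier crossing. The sign of the derivative
  matters only on the level \<open>c\<close>, so no differential inequality has to be
  integrated.\<close>

lemma less_if_decreasing_at_level:
  fixes y :: "real \<Rightarrow> real"
  assumes "a \<le> b" and cont: "continuous_on {a..b} y" and "y a < c"
    and decr: "\<And>t. a < t \<Longrightarrow> t \<le> b \<Longrightarrow> y t = c \<Longrightarrow> \<exists>D<0. (y has_real_derivative D) (at t)"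
  shows "y b < c"
proof (rule ccontr)
  assume "\<not> y b < c"
  have hit: "\<exists>s\<in>{a..t}. y s = c" if "t \<in> {a..b}" "c \<le> y t" for t
    using IVT'[of y a c t] that \<open>y a < c\<close> continuous_on_subset[OF cont, of "{a..t}"] by auto
  define Z where "Z = {t \<in> {a..b}. y t = c}"
  have "Z \<noteq> {}"
    using hit[of b] \<open>\<not> y b < c\<close> \<open>a \<le> b\<close> unfolding Z_def by auto
  \<comment> \<open>Compactness makes the infimum of the hitting times an attained minimum.\<close>
  moreover have "compact Z"
  proof -
    have "closed ({a..b} \<inter> y -` {c})"
      by (rule continuous_closed_preimage[OF cont]) auto
    moreover have "Z = {a..b} \<inter> ({a..b} \<inter> y -` {c})"
      by (auto simp: Z_def)
    ultimately show ?thesis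
      by (metis compact_Icc compact_Int_closed)
  qed
  ultimately obtain t where t: "t \<in> Z" and least: "\<And>s. s \<in> Z \<Longrightarrow> t \<le> s"
    using compact_attains_inf[of Z] by auto
  have "y t = c" "t \<in> {a..b}"
    using t by (simp_all add: Z_def)
  then have "a < t"
    using \<open>y a < c\<close> by (cases "t = a") simp_all
  then obtain D where "D < 0" "(y has_real_derivative D) (at t)"
    using decr[of t] \<open>y t = c\<close> \<open>t \<in> {a..b}\<close> by auto
  then obtain e where e: "e > 0" "\<And>h. 0 < h \<Longrightarrow> h < e \<Longrightarrow> y t < y (t - h)"
    using DERIV_neg_dec_left[of y D t] by auto
  \<comment> \<open>The bound \<open>e / 2\<close> keeps the step in the range where
    \<open>y\<close> exceeds its value at \<open>t\<close>; the bound \<open>t - a\<close> keeps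
    \<open>t - h\<close> in the interval.\<close>
  define h where "h = min (e / 2) (t - a)"
  have "0 < h" "h < e" "h \<le> t - a"
    using e(1) \<open>a < t\<close> by (auto simp: h_def)
  then have "c \<le> y (t - h)" "t - h \<in> {a..b}"
    using e(2)[of h] \<open>y t = c\<close> \<open>t \<in> {a..b}\<close> by simp_all
  from hit[OF this(2,1)] obtain s where "s \<in> {a..t - h}" "y s = c" ..
  then have "s \<in> Z" "s < t"
    using \<open>t \<in> {a..b}\<close> \<open>0 < h\<close> by (simp_all add: Z_def)
  with least[of s] show False by simp
qed

section \<open>Invariance of the energy ball\<close>

theorem theoremS1:
  fixes k :: nat and P :: profile and \<Phi> :: "component \<Rightarrow> field"
    and T :: ereal and \<delta> :: "real \<Rightarrow> perturbation"
    and \<Lambda>L_low \<Lambda>L_high \<Lambda>DL_low \<Lambda>DL_high \<Lambda>N3 \<Lambda>DN3 \<Lambda>R :: real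
    and \<mu> \<Lambda>stab \<Lambda>3 \<delta>star :: real
  assumes "k \<ge> 4"
    and "profile_ok k P"
    and "weights_ok \<Phi>"
    and "0 < T"
    and "0 < \<mu>" "\<mu> \<le> 1"
    and "admissible_solution P \<Phi> k \<mu> T \<delta>"
    and "\<And>t. 0 \<le> t \<Longrightarrow> ereal t < T \<Longrightarrow>
        pairing (\<Phi> I\<omega>) (lin_omega P (\<delta> t)) (domega (\<delta> t))
        + pairing (\<Phi> Ir) (dr (lin_u P (\<delta> t))) (dr (du (\<delta> t)))
        + pairing (\<Phi> Iz) (dz (lin_u P (\<delta> t))) (dz (du (\<delta> t)))
      \<le> - \<Lambda>L_low * (energy_0 \<Phi> (\<delta> t))\<^sup>2 + \<Lambda>L_high * (energy_high \<Phi> k (\<delta> t))\<^sup>2"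
    and "\<And>t. 0 \<le> t \<Longrightarrow> ereal t < T \<Longrightarrow>
        (\<Sum>i\<in>components. \<Sum>\<alpha>\<in>multi_indices k.
           pairing (weight_k \<Phi> k i) (partial \<alpha> (lin P i (\<delta> t))) (partial \<alpha> (dv i (\<delta> t))))
      \<le> \<Lambda>DL_low * (energy_0 \<Phi> (\<delta> t))\<^sup>2 - \<Lambda>DL_high * (energy_high \<Phi> k (\<delta> t))\<^sup>2"
    and "\<And>t. 0 \<le> t \<Longrightarrow> ereal t < T \<Longrightarrow>
        \<bar>pairing (\<Phi> I\<omega>) (nonlin_omega (\<delta> t)) (domega (\<delta> t))
         + pairing (\<Phi> Ir) (dr (nonlin_u (\<delta> t))) (dr (du (\<delta> t)))
         + pairing (\<Phi> Iz) (dz (nonlin_u (\<delta> t))) (dz (du (\<delta> t)))\<bar>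
      \<le> \<Lambda>N3 * (energy \<Phi> k \<mu> (\<delta> t)) ^ 3"
    and "\<And>t. 0 \<le> t \<Longrightarrow> ereal t < T \<Longrightarrow>
        \<mu> * \<bar>\<Sum>i\<in>components. \<Sum>\<alpha>\<in>multi_indices k.
           pairing (weight_k \<Phi> k i) (partial \<alpha> (nonlin i (\<delta> t))) (partial \<alpha> (dv i (\<delta> t)))\<bar>
      \<le> \<Lambda>DN3 * (energy \<Phi> k \<mu> (\<delta> t)) ^ 3"
    and "\<And>t. 0 \<le> t \<Longrightarrow> ereal t < T \<Longrightarrow>
        \<bar>(\<Sum>i\<in>components. pairing (\<Phi> i) (residual P i) (dv i (\<delta> t)))
         + \<mu> * (\<Sum>i\<in>components. \<Sum>\<alpha>\<in>multi_indices k.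
             pairing (weight_k \<Phi> k i) (partial \<alpha> (residual P i)) (partial \<alpha> (dv i (\<delta> t))))\<bar>
      \<le> \<Lambda>R * energy \<Phi> k \<mu> (\<delta> t)"
    and "\<Lambda>stab = min (\<Lambda>L_low - \<mu> * \<Lambda>DL_low) (\<Lambda>DL_high - \<Lambda>L_high / \<mu>)"
    and "\<Lambda>stab > 0"
    and "\<Lambda>3 = \<Lambda>N3 + \<Lambda>DN3"
    and "\<delta>star > 0"
    and "\<Lambda>3 * \<delta>star + \<Lambda>R / \<delta>star < \<Lambda>stab"
    and "energy \<Phi> k \<mu> (\<delta> 0) < \<delta>star"
  shows "\<forall>t. 0 \<le> t \<and> ereal t < T \<longrightarrow> energy \<Phi> k \<mu> (\<delta> t) < \<delta>star"
proof (intro allI impI)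
  note profile = assms(2) and mu = assms(5) and solution = assms(7)
    and L_est = assms(8) and DL_est = assms(9) and N_est = assms(10) and DN_est = assms(11)
    and R_est = assms(12) and stab = assms(13) and star_pos = assms(16) and star = assms(17)
  \<comment> \<open>The square is used because the energy identity differentiates it directly; the
    square root need not be differentiated.\<close>
  define y where "y = (\<lambda>t. (energy \<Phi> k \<mu> (\<delta> t))\<^sup>2)"
  have identity: "energy_identity \<Phi> k \<mu> T \<delta>" and "solves P T \<delta>"
    and adm: "\<And>t. 0 \<le> t \<Longrightarrow> ereal t < T \<Longrightarrow> admissible P \<Phi> k (\<delta> t)"
    using solution unfolding admissible_solution_def by simp_all
  have decr: "\<exists>D<0. (y has_real_derivative D) (at t)"
    if t: "0 < t" "ereal t < T" and "y t = \<delta>star\<^sup>2" for t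
  proof -
    define E where "E = energy \<Phi> k \<mu> (\<delta> t)"
    define E0 where "E0 = (energy_0 \<Phi> (\<delta> t))\<^sup>2"
    define H where "H = (energy_high \<Phi> k (\<delta> t))\<^sup>2"
    have E: "E = \<delta>star"
      using \<open>y t = \<delta>star\<^sup>2\<close> star_pos energy_nonneg[of \<mu> \<Phi> k "\<delta> t"] mu
      unfolding y_def E_def by (simp add: power2_eq_iff_nonneg)
    have E2: "E\<^sup>2 = E0 + \<mu> * H"
      using mu by (simp add: E_def E0_def H_def energy_power2)
    \<comment> \<open>As functionals of a family of fields, \<open>low\<close> and
      \<open>high\<close> apply alike to the time derivative and to its three parts.\<close>
    define low where "low = (\<lambda>f. \<Sum>i\<in>components. pairing (\<Phi> i) (f i) (dv i (\<delta> t)))"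
    define high where "high = (\<lambda>f. \<Sum>i\<in>components. \<Sum>\<alpha>\<in>multi_indices k.
      pairing (weight_k \<Phi> k i) (partial \<alpha> (f i)) (partial \<alpha> (dv i (\<delta> t))))"
    define L N where "L = (\<lambda>i. lin P i (\<delta> t))" and "N = (\<lambda>i. nonlin i (\<delta> t))"
    have "y differentiable (at t)"
      and half: "1 / 2 * deriv y t = low (\<lambda>i. time_deriv (\<lambda>s. dv i (\<delta> s)) t)
        + \<mu> * high (\<lambda>i. time_deriv (\<lambda>s. dv i (\<delta> s)) t)"
      using identity t unfolding energy_identity_def y_def low_def high_def by simp_all
    have "admissible P \<Phi> k (\<delta> t)"
      using adm t by simp
    note pairings = pairing_time_deriv_dv[OF profile this \<open>solves P T \<delta>\<close> t]
    have "low (\<lambda>i. time_deriv (\<lambda>s. dv i (\<delta> s)) t) = low L + low N + low (residual P)"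
      unfolding low_def L_def N_def by (simp add: pairings sum.distrib)
    moreover have "high (\<lambda>i. time_deriv (\<lambda>s. dv i (\<delta> s)) t) = high L + high N + high (residual P)"
      unfolding high_def L_def N_def by (simp add: pairings sum.distrib)
    ultimately have split: "1 / 2 * deriv y t = (low L + \<mu> * high L) + (low N + \<mu> * high N)
        + (low (residual P) + \<mu> * high (residual P))"
      using half by (simp add: algebra_simps)
    have "low L \<le> - \<Lambda>L_low * E0 + \<Lambda>L_high * H"
      using L_est[of t] t by (simp add: low_def L_def E0_def H_def components_def add.assoc)
    moreover have "\<mu> * high L \<le> \<mu> * (\<Lambda>DL_low * E0 - \<Lambda>DL_high * H)"
      using DL_est[of t] t mu by (simp add: high_def L_def E0_def H_def)
    \<comment> \<open>The energy \<open>E\<^sup>2\<close> is split as \<open>E0 + \<mu> * H\<close>,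
      and each entry of the minimum bounds one share. Pairing the second entry with
      \<open>\<mu> * H\<close> cancels the division by \<open>\<mu>\<close> and recovers the
      coefficient of \<open>H\<close> in \<open>low L + \<mu> * high L\<close>.\<close>
    moreover have "\<Lambda>stab * E0 \<le> (\<Lambda>L_low - \<mu> * \<Lambda>DL_low) * E0"
      by (rule mult_right_mono) (simp_all add: stab E0_def)
    moreover have "\<Lambda>stab * (\<mu> * H) \<le> (\<Lambda>DL_high - \<Lambda>L_high / \<mu>) * (\<mu> * H)"
      by (rule mult_right_mono) (use mu in \<open>simp_all add: stab H_def\<close>)
    moreover have "(\<Lambda>DL_high - \<Lambda>L_high / \<mu>) * (\<mu> * H) = \<mu> * \<Lambda>DL_high * H - \<Lambda>L_high * H"
      using mu by (simp add: field_simps)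
    ultimately have linear: "low L + \<mu> * high L \<le> - \<Lambda>stab * E\<^sup>2"
      unfolding E2 by (simp add: algebra_simps)
    have "low N \<le> \<Lambda>N3 * E ^ 3"
      using N_est[of t] t by (simp add: low_def N_def E_def components_def add.assoc)
    moreover have "\<mu> * high N \<le> \<mu> * \<bar>high N\<bar>"
      using mu by (simp add: mult_left_mono)
    moreover have "\<mu> * \<bar>high N\<bar> \<le> \<Lambda>DN3 * E ^ 3"
      using DN_est[of t] t by (simp add: high_def N_def E_def)
    ultimately have nonlinear: "low N + \<mu> * high N \<le> \<Lambda>3 * E ^ 3"
      by (simp add: assms(15) algebra_simps)
    have res: "low (residual P) + \<mu> * high (residual P) \<le> \<Lambda>R * E"
      using R_est[of t] t by (simp add: low_def high_def E_def)
    have "1 / 2 * deriv y t \<le> - \<Lambda>stab * E\<^sup>2 + \<Lambda>3 * E ^ 3 + \<Lambda>R * E"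
      using split linear nonlinear res by linarith
    \<comment> \<open>Since \<open>E = \<delta>star\<close>, all three terms share the factor
      \<open>\<delta>star\<^sup>2\<close>, which exposes the smallness condition on
      \<open>\<delta>star\<close>.\<close>
    also have "\<dots> = \<delta>star\<^sup>2 * (\<Lambda>3 * \<delta>star + \<Lambda>R / \<delta>star - \<Lambda>stab)"
      using star_pos by (simp add: E algebra_simps power2_eq_square power3_eq_cube)
    also have "\<dots> < 0"
      using star star_pos by (simp add: mult_less_0_iff)
    finally have "deriv y t < 0" by simp
    then show ?thesis
      using \<open>y differentiable (at t)\<close> DERIV_deriv_iff_real_differentiable by blast
  qed
  fix t :: real
  assume "0 \<le> t \<and> ereal t < T"
  then have t: "0 \<le> t" "ereal t < T" by simp_all
  \<comment> \<open>The barrier is applied on the compact interval from \<open>0\<close> to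
    \<open>t\<close>, which must lie in the lifespan; \<open>T\<close> may be infinite.\<close>
  have before: "ereal s < T" if "s \<le> t" for s
    using that t(2) by (meson ereal_less_eq(3) le_less_trans)
  have "y t < \<delta>star\<^sup>2"
  proof (rule less_if_decreasing_at_level[where a = 0 and b = t and y = y])
    have "continuous_on {t. 0 \<le> t \<and> ereal t < T} y"
      using identity unfolding energy_identity_def y_def by simp
    then show "continuous_on {0..t} y"
      by (rule continuous_on_subset) (use before in auto)
    show "y 0 < \<delta>star\<^sup>2"
      using assms(18) energy_nonneg[of \<mu> \<Phi> k "\<delta> 0"] mu unfolding y_def
      by (simp add: power_strict_mono)
    show "\<exists>D<0. (y has_real_derivative D) (at s)" if "0 < s" "s \<le> t" "y s = \<delta>star\<^sup>2" for s
      using decr that before by simp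
  qed (rule t(1))
  then show "energy \<Phi> k \<mu> (\<delta> t) < \<delta>star"
    using star_pos unfolding y_def by (simp add: power2_less_imp_less)
qed

end
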